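(* There are positive universal constants $c_1,c_2$ such that the following holds. For $d\ge2$ let $f_d(\mathbf{x})=\frac{1}{2\pi d^3}\sin\!\big(2\pi d^3\|\mathbf{x}\|^2\big)$ on $B_d$ (a $1$-Lipschitz function). Let $w(d,1/\epsilon)$ be a width function such that for every $d\ge 2$ and every $\epsilon>0$ there is a depth-$2$ ReLU network $N$ of width $w(d,1/\epsilon)$, all of whose weights are bounded in absolute value by $\frac{2^{d+1}}{2\pi d^3}$, satisfying $\sup_{\mathbf{x}\in B_d}|N(\mathbf{x})-f_d(\mathbf{x})|\le\epsilon$. Then for every $d>c_1$, $$w\big(d,\,101\,e^{2}\pi^3 d^3\big)\ge 2^{c_2 d\log d}.$$ In particular, depth-$2$ networks of width $\mathrm{poly}(d,1/\epsilon)$ (with such weight bounds) cannot approximate $f_d$ to accuracy $\epsilon$.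
   Context: $\|\cdot\|$ is the Euclidean norm, $B_d=\{\mathbf{x}\in\mathbb{R}^d:\|\mathbf{x}\|\le1\}$. A depth-$2$ ReLU network of width $w$ is $\mathbf{x}\mapsto\sum_{i=1}^{w}v_i\max\{0,\mathbf{w}_i^\top\mathbf{x}+b_i\}+b_0$.
   Formalization: The parenthetical claim that f_d is 1-Lipschitz is dropped because it is false (its gradient has norm 2 at ‖x‖=1); the closing "in particular" sentence on poly width, an immediate consequence, is not stated separately. *)

theory Defs
  imports "HOL-Analysis.Analysis"
begin

text \<open>Points of R^d are represented as functions nat => real; only coordinates i < d matter.\<close>

definition eucl_norm :: "nat \<Rightarrow> (nat \<Rightarrow> real) \<Rightarrow> real" where
  "eucl_norm d x = sqrt (\<Sum>i<d. (x i)^2)"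

definition unit_ball :: "nat \<Rightarrow> (nat \<Rightarrow> real) set" where
  "unit_ball d = {x. (\<forall>i\<ge>d. x i = 0) \<and> eucl_norm d x \<le> 1}"

text \<open>Depth-2 ReLU network of width k: hidden weights W j (a vector), biases b j,
  output weights v j, output bias b0.\<close>
definition relu_net2 ::
  "nat \<Rightarrow> nat \<Rightarrow> (nat \<Rightarrow> real) \<Rightarrow> (nat \<Rightarrow> nat \<Rightarrow> real) \<Rightarrow> (nat \<Rightarrow> real) \<Rightarrow> real
     \<Rightarrow> (nat \<Rightarrow> real) \<Rightarrow> real" where
  "relu_net2 d k v W b b0 x =
     (\<Sum>j<k. v j * max 0 ((\<Sum>i<d. W j i * x i) + b j)) + b0"

definition weights_bounded ::
  "nat \<Rightarrow> nat \<Rightarrow> real \<Rightarrow> (nat \<Rightarrow> real) \<Rightarrow> (nat \<Rightarrow> nat \<Rightarrow> real) \<Rightarrow> (nat \<Rightarrow> real) \<Rightarrow> real \<Rightarrow> bool" where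
  "weights_bounded d k B v W b b0 \<longleftrightarrow>
     (\<forall>j<k. \<bar>v j\<bar> \<le> B \<and> \<bar>b j\<bar> \<le> B \<and> (\<forall>i<d. \<bar>W j i\<bar> \<le> B)) \<and> \<bar>b0\<bar> \<le> B"

definition f_target :: "nat \<Rightarrow> (nat \<Rightarrow> real) \<Rightarrow> real" where
  "f_target d x = sin (2 * pi * real d ^ 3 * (eucl_norm d x)^2) / (2 * pi * real d ^ 3)"

end

theory Submission
  imports Defs "HOL-Real_Asymp.Real_Asymp"
begin

text \<open>
  Integrate over balls of squared radius \<open>s\<close> in odd dimension \<open>n = 2 p + 1 \<in> {d - 1, d}\<close>. By rotation
  invariance, the integral of a neuron $\max(0, \langle w, x\rangle + b)$ is a constant times
  $\int \max(0, |w| t + b) (s - t^2)_+^p\,dt$. As a function of \<open>s\<close> it is \<open>p\<close> times integrated, so its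
  \<open>p\<close>-th finite difference with step \<open>h = 1/(2 d\<^sup>3)\<close> is of order \<open>p! h\<^sup>p \<le> (4 d\<^sup>2)\<^sup>-\<^sup>p\<close>.
  The same step is half a period of the target as a function of the squared radius, so the
  alternating signs of the finite difference match those of the target on thin shells around its
  extrema, and no cancellation occurs. A network close to the target therefore needs about
  \<open>d\<^sup>2\<^sup>p\<close> neurons, up to factors exponential in \<open>d\<close>, which absorb the weight bound.
\<close>

subsection \<open>Ridge functions and rotation invariance\<close>

text \<open>The rotation splits into two one-dimensional affine substitutions: first
  \<open>u = c * t + s * z\<close> at fixed \<open>z\<close>, which turns the second argument into
  \<open>(z - s * u) / c\<close>, then a substitution in \<open>z\<close> at fixed \<open>u\<close>.
  Their factors \<open>\<bar>c\<bar>\<close> cancel. For \<open>c = 0\<close> the rotation is a swap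
  with a sign.\<close>

lemma nn_integral_rotate_plane:
  fixes G :: "real \<Rightarrow> real \<Rightarrow> ennreal" and c s :: real
  assumes [measurable]: "case_prod G \<in> borel_measurable (borel \<Otimes>\<^sub>M borel)" and cs: "c\<^sup>2 + s\<^sup>2 = 1"
  shows "(\<integral>\<^sup>+z. \<integral>\<^sup>+t. G (c * t + s * z) (c * z - s * t) \<partial>lborel \<partial>lborel) = (\<integral>\<^sup>+z. \<integral>\<^sup>+t. G t z \<partial>lborel \<partial>lborel)"
proof (cases "c = 0")
  case True
  then have s: "\<bar>s\<bar> = 1" "s \<noteq> 0" using cs by (auto simp: power2_eq_1_iff)
  have "(\<integral>\<^sup>+z. \<integral>\<^sup>+t. G (c * t + s * z) (c * z - s * t) \<partial>lborel \<partial>lborel) = (\<integral>\<^sup>+z. \<integral>\<^sup>+t. G (s * z) t \<partial>lborel \<partial>lborel)"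
  proof (rule nn_integral_cong)
    fix z :: real
    show "(\<integral>\<^sup>+t. G (c * t + s * z) (c * z - s * t) \<partial>lborel) = (\<integral>\<^sup>+t. G (s * z) t \<partial>lborel)"
      using nn_integral_real_affine[of "\<lambda>t. G (s * z) t" "- s" 0] s True by simp
  qed
  also have "\<dots> = (\<integral>\<^sup>+z. \<integral>\<^sup>+t. G z t \<partial>lborel \<partial>lborel)"
    using nn_integral_real_affine[of "\<lambda>z. \<integral>\<^sup>+t. G z t \<partial>lborel" s 0] s by simp
  also have "\<dots> = (\<integral>\<^sup>+z. \<integral>\<^sup>+t. G t z \<partial>lborel \<partial>lborel)"
    by (rule lborel_pair.Fubini') simp
  finally show ?thesis .
next
  case False
  have "ennreal \<bar>c\<bar> * (\<integral>\<^sup>+z. \<integral>\<^sup>+t. G (c * t + s * z) (c * z - s * t) \<partial>lborel \<partial>lborel)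
      = (\<integral>\<^sup>+z. ennreal \<bar>c\<bar> * (\<integral>\<^sup>+t. G (c * t + s * z) (c * z - s * t) \<partial>lborel) \<partial>lborel)"
    by (rule nn_integral_cmult[symmetric]) measurable
  also have "\<dots> = (\<integral>\<^sup>+z. \<integral>\<^sup>+u. G u ((z - s * u) / c) \<partial>lborel \<partial>lborel)"
  proof (rule nn_integral_cong)
    fix z :: real
    have "(z - s * (s * z + c * t)) / c = c * z - s * t" for t
    proof -
      have "z - s * (s * z + c * t) = (c\<^sup>2 + s\<^sup>2) * z - s * (s * z + c * t)" using cs by simp
      also have "\<dots> = c * (c * z - s * t)" by (simp add: algebra_simps power2_eq_square)
      finally show ?thesis using False by simp
    qed
    then show "ennreal \<bar>c\<bar> * (\<integral>\<^sup>+t. G (c * t + s * z) (c * z - s * t) \<partial>lborel) = (\<integral>\<^sup>+u. G u ((z - s * u) / c) \<partial>lborel)"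
      using nn_integral_real_affine[of "\<lambda>u. G u ((z - s * u) / c)" c "s * z"] False by (simp add: add.commute)
  qed
  also have "\<dots> = (\<integral>\<^sup>+u. \<integral>\<^sup>+z. G u ((z - s * u) / c) \<partial>lborel \<partial>lborel)"
    by (rule lborel_pair.Fubini') simp
  also have "\<dots> = (\<integral>\<^sup>+u. ennreal \<bar>c\<bar> * (\<integral>\<^sup>+z. G u z \<partial>lborel) \<partial>lborel)"
  proof (rule nn_integral_cong)
    fix u :: real
    show "(\<integral>\<^sup>+z. G u ((z - s * u) / c) \<partial>lborel) = ennreal \<bar>c\<bar> * (\<integral>\<^sup>+z. G u z \<partial>lborel)"
      using nn_integral_real_affine[of "\<lambda>z. G u ((z - s * u) / c)" c "s * u"] False by simp
  qed
  also have "\<dots> = ennreal \<bar>c\<bar> * (\<integral>\<^sup>+u. \<integral>\<^sup>+z. G u z \<partial>lborel \<partial>lborel)"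
    by (rule nn_integral_cmult) measurable
  also have "(\<integral>\<^sup>+u. \<integral>\<^sup>+z. G u z \<partial>lborel \<partial>lborel) = (\<integral>\<^sup>+z. \<integral>\<^sup>+t. G t z \<partial>lborel \<partial>lborel)"
    by (rule lborel_pair.Fubini') simp
  finally show ?thesis using False by (simp add: ennreal_mult_cancel_left)
qed

text \<open>Rotating the direction \<open>(a, b)\<close> onto the first axis keeps
  \<open>t\<^sup>2 + z\<^sup>2\<close> fixed.\<close>

lemma nn_integral_plane_ridge:
  fixes G :: "real \<Rightarrow> real \<Rightarrow> ennreal" and a b :: real
  assumes [measurable]: "case_prod G \<in> borel_measurable (borel \<Otimes>\<^sub>M borel)"
  shows "(\<integral>\<^sup>+z. \<integral>\<^sup>+t. G (a * t + b * z) (t\<^sup>2 + z\<^sup>2) \<partial>lborel \<partial>lborel)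
       = (\<integral>\<^sup>+z. \<integral>\<^sup>+t. G (sqrt (a\<^sup>2 + b\<^sup>2) * t) (t\<^sup>2 + z\<^sup>2) \<partial>lborel \<partial>lborel)"
proof (cases "a\<^sup>2 + b\<^sup>2 = 0")
  case True
  then show ?thesis by (simp add: sum_power2_eq_zero_iff)
next
  case False
  define r where "r = sqrt (a\<^sup>2 + b\<^sup>2)"
  have r2: "r\<^sup>2 = a\<^sup>2 + b\<^sup>2" by (simp add: r_def)
  with False have r: "r \<noteq> 0" by auto
  have cs: "(a / r)\<^sup>2 + (b / r)\<^sup>2 = 1"
    using r2 False by (simp add: power_divide add_divide_distrib[symmetric])
  have "(a / r * t + b / r * z)\<^sup>2 + (a / r * z - b / r * t)\<^sup>2 = ((a / r)\<^sup>2 + (b / r)\<^sup>2) * (t\<^sup>2 + z\<^sup>2)" for t z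
    by algebra
  then have q: "(a / r * t + b / r * z)\<^sup>2 + (a / r * z - b / r * t)\<^sup>2 = t\<^sup>2 + z\<^sup>2" for t z
    using cs by simp
  have l: "r * (a / r * t + b / r * z) = a * t + b * z" for t z
    using r by (simp add: distrib_left)
  have "(\<integral>\<^sup>+z. \<integral>\<^sup>+t. G (r * t) (t\<^sup>2 + z\<^sup>2) \<partial>lborel \<partial>lborel) = (\<integral>\<^sup>+z. \<integral>\<^sup>+t. G (a * t + b * z) (t\<^sup>2 + z\<^sup>2) \<partial>lborel \<partial>lborel)"
    using nn_integral_rotate_plane[OF _ cs, of "\<lambda>t z. G (r * t) (t\<^sup>2 + z\<^sup>2)"]
    by (simp only: l q) simp
  then show ?thesis by (simp add: r_def)
qed

text \<open>Induction on the dimension. The last coordinate \<open>z\<close> is split off, the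
  hypothesis is applied to \<open>H\<close> with both arguments shifted by the contribution of
  \<open>z\<close>, and a rotation in the \<open>(t, z)\<close> plane merges the two remaining
  directions. Then \<open>z\<close> joins the orthogonal coordinates \<open>y\<close>.\<close>

lemma nn_integral_PiM_ridge:
  fixes H :: "real \<Rightarrow> real \<Rightarrow> ennreal" and w :: "nat \<Rightarrow> real"
  assumes [measurable]: "case_prod H \<in> borel_measurable (borel \<Otimes>\<^sub>M borel)"
  shows "(\<integral>\<^sup>+x. H (\<Sum>i<Suc k. w i * x i) (\<Sum>i<Suc k. (x i)\<^sup>2) \<partial>(\<Pi>\<^sub>M i\<in>{..<Suc k}. lborel))
       = (\<integral>\<^sup>+t. \<integral>\<^sup>+y. H (sqrt (\<Sum>i<Suc k. (w i)\<^sup>2) * t) (t\<^sup>2 + (\<Sum>i<k. (y i)\<^sup>2)) \<partial>(\<Pi>\<^sub>M i\<in>{..<k}. lborel) \<partial>lborel)"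
  using assms
proof (induction k arbitrary: H)
  case (0 H)
  note [measurable] = 0
  interpret product_sigma_finite "\<lambda>_::nat. lborel :: real measure" ..
  have "(\<integral>\<^sup>+x. H (\<Sum>i<Suc 0. w i * x i) (\<Sum>i<Suc 0. (x i)\<^sup>2) \<partial>(\<Pi>\<^sub>M i\<in>{..<Suc 0}. lborel))
      = (\<integral>\<^sup>+t. H (w 0 * t) (t\<^sup>2) \<partial>lborel)"
    using product_nn_integral_singleton[of "\<lambda>t. H (w 0 * t) (t\<^sup>2)" 0] by (simp add: lessThan_Suc)
  \<comment> \<open>In dimension one the only rotation is the reflection of \<open>t\<close>, which
    removes the sign of \<open>w 0\<close>.\<close>
  also have "\<dots> = (\<integral>\<^sup>+t. H (\<bar>w 0\<bar> * t) (t\<^sup>2) \<partial>lborel)"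
  proof (cases "w 0 \<ge> 0")
    case False
    then show ?thesis
      using nn_integral_real_affine[of "\<lambda>t. H (\<bar>w 0\<bar> * t) (t\<^sup>2)" "-1" 0] by simp
  qed simp
  also have "\<dots> = (\<integral>\<^sup>+t. \<integral>\<^sup>+y. H (sqrt (\<Sum>i<Suc 0. (w i)\<^sup>2) * t) (t\<^sup>2 + (\<Sum>i<0. (y i)\<^sup>2)) \<partial>(\<Pi>\<^sub>M i\<in>{..<(0::nat)}. lborel) \<partial>lborel)"
    by (simp add: space_PiM emeasure_PiM_empty)
  finally show ?case .
next
  case (Suc k H)
  note [measurable] = Suc.prems
  interpret product_sigma_finite "\<lambda>_::nat. lborel :: real measure" ..
  interpret P: sigma_finite_measure "\<Pi>\<^sub>M i\<in>{..<k}. (lborel :: real measure)"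
    by (rule sigma_finite) simp
  \<comment> \<open>Integrating out the other coordinates leaves a function of two reals, as the
    planar lemma requires.\<close>
  define G where "G u q = (\<integral>\<^sup>+y. H u (q + (\<Sum>i<k. (y i)\<^sup>2)) \<partial>(\<Pi>\<^sub>M i\<in>{..<k}. lborel))" for u q
  have G[measurable]: "case_prod G \<in> borel_measurable (borel \<Otimes>\<^sub>M borel)"
    unfolding G_def by measurable
  define r where "r = sqrt (\<Sum>i<Suc k. (w i)\<^sup>2)"
  define r' where "r' = sqrt (\<Sum>i<Suc (Suc k). (w i)\<^sup>2)"
  have rr: "sqrt (r\<^sup>2 + (w (Suc k))\<^sup>2) = r'"
    unfolding r_def r'_def by (subst real_sqrt_pow2) (simp_all add: sum_nonneg del: sum.lessThan_Suc, simp)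
  have ins: "{..<Suc n} = insert n {..<n}" for n by auto
  have "(\<integral>\<^sup>+x. H (\<Sum>i<Suc (Suc k). w i * x i) (\<Sum>i<Suc (Suc k). (x i)\<^sup>2) \<partial>(\<Pi>\<^sub>M i\<in>{..<Suc (Suc k)}. lborel))
     = (\<integral>\<^sup>+z. \<integral>\<^sup>+x. H ((\<Sum>i<Suc k. w i * x i) + w (Suc k) * z) ((\<Sum>i<Suc k. (x i)\<^sup>2) + z\<^sup>2)
          \<partial>(\<Pi>\<^sub>M i\<in>{..<Suc k}. lborel) \<partial>lborel)"
    unfolding ins[of "Suc k"]
    by (subst product_nn_integral_insert_rev) (auto simp: sum.insert simp flip: ins intro!: nn_integral_cong arg_cong2[where f=H] sum.cong)
  also have "\<dots> = (\<integral>\<^sup>+z. \<integral>\<^sup>+t. \<integral>\<^sup>+y. H (r * t + w (Suc k) * z) (t\<^sup>2 + (\<Sum>i<k. (y i)\<^sup>2) + z\<^sup>2)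
          \<partial>(\<Pi>\<^sub>M i\<in>{..<k}. lborel) \<partial>lborel \<partial>lborel)"
    unfolding r_def
    by (intro nn_integral_cong Suc.IH[of "\<lambda>u q. H (u + w (Suc k) * z) (q + z\<^sup>2)" for z]) measurable
  also have "\<dots> = (\<integral>\<^sup>+z. \<integral>\<^sup>+t. G (r * t + w (Suc k) * z) (t\<^sup>2 + z\<^sup>2) \<partial>lborel \<partial>lborel)"
    by (simp add: G_def add_ac)
  also have "\<dots> = (\<integral>\<^sup>+z. \<integral>\<^sup>+t. G (r' * t) (t\<^sup>2 + z\<^sup>2) \<partial>lborel \<partial>lborel)"
    by (subst nn_integral_plane_ridge) (simp_all add: rr)
  also have "\<dots> = (\<integral>\<^sup>+t. \<integral>\<^sup>+z. G (r' * t) (t\<^sup>2 + z\<^sup>2) \<partial>lborel \<partial>lborel)"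
    by (rule lborel_pair.Fubini') simp
  also have "\<dots> = (\<integral>\<^sup>+t. \<integral>\<^sup>+y. H (r' * t) (t\<^sup>2 + (\<Sum>i<Suc k. (y i)\<^sup>2)) \<partial>(\<Pi>\<^sub>M i\<in>{..<Suc k}. lborel) \<partial>lborel)"
    unfolding ins[of k]
    by (subst product_nn_integral_insert_rev) (auto simp: G_def add_ac intro!: nn_integral_cong arg_cong2[where f=H] sum.cong)
  finally show ?case by (simp only: r'_def)
qed

subsection \<open>Finite differences of truncated powers\<close>

text \<open>The sign is attached to \<open>i\<close>, so this is \<open>(-1) ^ m\<close> times the
  usual forward difference; the signs then follow those of the target at successive extrema.\<close>

definition fin_diff :: "nat \<Rightarrow> real \<Rightarrow> (real \<Rightarrow> real) \<Rightarrow> real \<Rightarrow> real" where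
  "fin_diff m h F x = (\<Sum>i\<le>m. (-1) ^ i * real (m choose i) * F (x + real i * h))"

lemma fin_diff_Suc: "fin_diff (Suc m) h F x = fin_diff m h F x - fin_diff m h F (x + h)"
proof -
  let ?g = "\<lambda>n i. (-1) ^ i * real (n choose i) * F (x + real i * h)"
  have "fin_diff (Suc m) h F x = ?g (Suc m) 0 + (\<Sum>i\<le>m. ?g (Suc m) (Suc i))"
    unfolding fin_diff_def by (rule sum.atMost_Suc_shift)
  also have "(\<Sum>i\<le>m. ?g (Suc m) (Suc i)) = (\<Sum>i\<le>m. ?g m (Suc i)) - fin_diff m h F (x + h)"
    unfolding fin_diff_def sum_subtractf[symmetric]
    by (rule sum.cong) (simp_all add: algebra_simps)
  also have "?g (Suc m) 0 + ((\<Sum>i\<le>m. ?g m (Suc i)) - fin_diff m h F (x + h))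
      = (\<Sum>i\<le>Suc m. ?g m i) - fin_diff m h F (x + h)"
    by (simp only: sum.atMost_Suc_shift[of "?g m"]) simp
  also have "(\<Sum>i\<le>Suc m. ?g m i) = fin_diff m h F x"
    by (simp add: fin_diff_def)
  finally show ?thesis .
qed

text \<open>An exponent of at least 2 flattens the kink at 0: the difference quotient there is at
  most \<open>max 0 h ^ Suc p\<close>, which tends to 0.\<close>

lemma has_real_derivative_truncated_power:
  "((\<lambda>x::real. max 0 x ^ Suc (Suc p)) has_real_derivative real (Suc (Suc p)) * max 0 x ^ Suc p) (at x)"
proof -
  consider "x > 0" | "x < 0" | "x = 0" by linarith
  then show ?thesis
  proof cases
    case 1
    have "((\<lambda>x. x ^ Suc (Suc p)) has_real_derivative real (Suc (Suc p)) * max 0 x ^ Suc p) (at x)"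
      using DERIV_pow[of "Suc (Suc p)" x] 1 by simp
    moreover have "eventually (\<lambda>y. max 0 y ^ Suc (Suc p) = y ^ Suc (Suc p)) (nhds x)"
      using eventually_nhds_in_open[of "{0<..}" x] 1 by (auto elim!: eventually_mono)
    ultimately show ?thesis by (subst DERIV_cong_ev[OF refl _ refl])
  next
    case 2
    have "((\<lambda>x. 0) has_real_derivative real (Suc (Suc p)) * max 0 x ^ Suc p) (at x)"
      using 2 by auto
    moreover have "eventually (\<lambda>y. max 0 y ^ Suc (Suc p) = (0::real)) (nhds x)"
      using eventually_nhds_in_open[of "{..<0}" x] 2 by (auto elim!: eventually_mono)
    ultimately show ?thesis by (subst DERIV_cong_ev[OF refl _ refl])
  next
    case 3
    have "((\<lambda>h. max 0 h ^ Suc (Suc p) / h) \<longlongrightarrow> 0) (at (0::real))"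
    proof (rule Lim_null_comparison)
      have "norm (max 0 h ^ Suc (Suc p) / h) \<le> max 0 h ^ Suc p" for h :: real
        by (cases "h > 0") (auto simp: max_def)
      then show "eventually (\<lambda>h. norm (max 0 h ^ Suc (Suc p) / h) \<le> max 0 h ^ Suc p) (at (0::real))"
        by simp
      have "isCont (\<lambda>h::real. max 0 h ^ Suc p) 0"
        by (intro continuous_intros)
      then show "((\<lambda>h::real. max 0 h ^ Suc p) \<longlongrightarrow> 0) (at 0)"
        by (simp add: isCont_def)
    qed
    then show ?thesis using 3 by (simp add: DERIV_def)
  qed
qed

lemma fin_diff_has_derivative:
  assumes "\<And>x. (F has_real_derivative F' x) (at x)"
  shows "(fin_diff m h F has_real_derivative fin_diff m h F' x) (at x)"
proof -
  have "((\<lambda>x. F (x + real i * h)) has_real_derivative F' (x + real i * h)) (at x)" for i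
    using DERIV_shift[of F "F' (x + real i * h)" x "real i * h"] assms by simp
  then have "((\<lambda>x. fin_diff m h F x) has_real_derivative fin_diff m h F' x) (at x)"
    unfolding fin_diff_def by (intro DERIV_sum DERIV_cmult)
  then show ?thesis .
qed

lemma fin_diff_cmult: "fin_diff m h (\<lambda>x. a * F x) x = a * fin_diff m h F x"
  by (simp add: fin_diff_def sum_distrib_left mult_ac)

text \<open>Raising the order by one gives the increment of \<open>fin_diff (Suc p)\<close> over a
  length \<open>h\<close>, and its derivative is \<open>Suc (Suc p)\<close> times the previous case,
  so the mean value bound contributes one factor of the factorial and one \<open>h\<close>. The
  induction starts at exponent 1, where \<open>max 0\<close> is 1-Lipschitz, because only higher
  powers are differentiable.\<close>

lemma fin_diff_truncated_power_le:
  assumes "h \<ge> 0"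
  shows "\<bar>fin_diff (Suc p) h (\<lambda>x. max 0 x ^ Suc p) x\<bar> \<le> fact (Suc p) * h ^ Suc p"
proof (induction p arbitrary: x)
  case 0
  show ?case using assms by (simp add: fin_diff_Suc) (simp add: fin_diff_def max_def)
next
  case (Suc p)
  let ?G = "fin_diff (Suc p) h (\<lambda>x. max 0 x ^ Suc (Suc p))"
  let ?G' = "\<lambda>x. real (Suc (Suc p)) * fin_diff (Suc p) h (\<lambda>x. max 0 x ^ Suc p) x"
  have G: "(?G has_real_derivative ?G' x) (at x)" for x
    using fin_diff_has_derivative[OF has_real_derivative_truncated_power, of "Suc p" h p x]
    unfolding fin_diff_cmult .
  have "norm (?G (x + h) - ?G x) \<le> (real (Suc (Suc p)) * (fact (Suc p) * h ^ Suc p)) * norm (x + h - x)"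
  proof (rule field_differentiable_bound[of UNIV])
    show "norm (?G' z) \<le> real (Suc (Suc p)) * (fact (Suc p) * h ^ Suc p)" for z
      using Suc.IH[of z] unfolding real_norm_def abs_mult by (intro mult_mono) auto
  qed (use G in auto)
  also have "\<dots> = fact (Suc (Suc p)) * h ^ Suc (Suc p)"
    using assms by simp
  finally show ?case unfolding fin_diff_Suc[of "Suc p"] by (simp add: abs_minus_commute)
qed

subsection \<open>Integrals of neurons over balls\<close>

text \<open>In even dimension the volume is an integer power of the squared radius, which is what
  makes truncated powers appear.\<close>

lemma emeasure_PiM_ball:
  assumes "k > 0" "s \<noteq> 0"
  shows "emeasure (\<Pi>\<^sub>M i\<in>{..<2 * k}. lborel) {y \<in> space (\<Pi>\<^sub>M i\<in>{..<2 * k}. lborel). (\<Sum>i<2 * k. (y i)\<^sup>2) \<le> s}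
       = ennreal (unit_ball_vol (real (2 * k)) * max 0 s ^ k)"
proof (cases "s > 0")
  case True
  have "{y \<in> space (\<Pi>\<^sub>M i\<in>{..<2 * k}. lborel). (\<Sum>i<2 * k. (y i)\<^sup>2) \<le> s}
      = {y. sqrt (\<Sum>i\<in>{..<2 * k}. (y i)\<^sup>2) \<le> sqrt s} \<inter> space (\<Pi>\<^sub>M i\<in>{..<2 * k}. lborel)"
    by auto
  moreover have "sqrt s ^ (2 * k) = max 0 s ^ k"
    using True by (simp add: power_mult)
  ultimately show ?thesis
    using emeasure_cball_aux[of "{..<2 * k}" "sqrt s"] True by simp
next
  case False
  then have "s < 0" using assms by simp
  then have "{y \<in> space (\<Pi>\<^sub>M i\<in>{..<2 * k}. lborel). (\<Sum>i<2 * k. (y i)\<^sup>2) \<le> s} = {}"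
    by (auto simp: not_le intro!: less_le_trans[of s 0] sum_nonneg)
  then show ?thesis using \<open>s < 0\<close> assms(1) by (simp only: emeasure_empty) (simp add: zero_power)
qed

text \<open>Up to the factor \<^term>\<open>unit_ball_vol (2 * p)\<close>, this is the integral of
  $x \mapsto \max(0, \langle w, x\rangle + b)$ over the ball of squared radius \<open>s \<le> 1\<close> in
  dimension \<open>2 p + 1\<close>, where \<open>r\<close> is the norm of \<open>w\<close>.\<close>
definition ridge_ball :: "nat \<Rightarrow> real \<Rightarrow> real \<Rightarrow> real \<Rightarrow> real" where
  "ridge_ball p r b s = (LINT t|lborel. indicator {-1..1} t * (max 0 (r * t + b) * max 0 (s - t\<^sup>2) ^ p))"

lemma integrable_ridge_ball:
  "integrable lborel (\<lambda>t::real. indicator {-1..1} t * (max 0 (r * t + b) * max 0 (s - t\<^sup>2) ^ p))"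
proof -
  have "continuous_on {-1..1} (\<lambda>t::real. max 0 (r * t + b) * max 0 (s - t\<^sup>2) ^ p)"
    by (intro continuous_intros)
  from borel_integrable_compact[OF _ this] show ?thesis by simp
qed

text \<open>After rotating \<open>w\<close> onto the \<open>t\<close> axis, the slice of the ball at
  height \<open>t\<close> is a ball of squared radius \<open>s - t\<^sup>2\<close> in dimension
  \<open>2 * p\<close>.\<close>

lemma has_bochner_integral_ridge_ball:
  fixes w :: "nat \<Rightarrow> real"
  assumes "p > 0" "s \<le> 1"
  defines "M \<equiv> (\<Pi>\<^sub>M i\<in>{..<Suc (2 * p)}. (lborel :: real measure))"
  shows "has_bochner_integral M
     (\<lambda>x. indicator {x. (\<Sum>i<Suc (2 * p). (x i)\<^sup>2) \<le> s} x * max 0 ((\<Sum>i<Suc (2 * p). w i * x i) + b))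
     (unit_ball_vol (real (2 * p)) * ridge_ball p (sqrt (\<Sum>i<Suc (2 * p). (w i)\<^sup>2)) b s)"
proof (rule has_bochner_integral_nn_integral)
  define r where "r = sqrt (\<Sum>i<Suc (2 * p). (w i)\<^sup>2)"
  define V where "V = unit_ball_vol (real (2 * p))"
  have V: "V \<ge> 0" by (simp add: V_def)
  let ?g = "\<lambda>t::real. indicator {-1..1} t * (max 0 (r * t + b) * max 0 (s - t\<^sup>2) ^ p)"
  let ?H = "\<lambda>u q. indicator {..s} q * ennreal (max 0 (u + b))"
  show "(\<lambda>x. indicator {x. (\<Sum>i<Suc (2 * p). (x i)\<^sup>2) \<le> s} x * max 0 ((\<Sum>i<Suc (2 * p). w i * x i) + b)) \<in> borel_measurable M"
    unfolding M_def by measurable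
  show "AE x in M. 0 \<le> indicator {x. (\<Sum>i<Suc (2 * p). (x i)\<^sup>2) \<le> s} x * max 0 ((\<Sum>i<Suc (2 * p). w i * x i) + b)"
    by simp
  show "0 \<le> unit_ball_vol (real (2 * p)) * ridge_ball p (sqrt (\<Sum>i<Suc (2 * p). (w i)\<^sup>2)) b s"
    unfolding ridge_ball_def by (intro mult_nonneg_nonneg Bochner_Integration.integral_nonneg) auto
  have "(\<integral>\<^sup>+x. ennreal (indicator {x. (\<Sum>i<Suc (2 * p). (x i)\<^sup>2) \<le> s} x * max 0 ((\<Sum>i<Suc (2 * p). w i * x i) + b)) \<partial>M)
      = (\<integral>\<^sup>+x. ?H (\<Sum>i<Suc (2 * p). w i * x i) (\<Sum>i<Suc (2 * p). (x i)\<^sup>2) \<partial>M)"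
    by (intro nn_integral_cong) (auto simp: indicator_def)
  also have "\<dots> = (\<integral>\<^sup>+t. \<integral>\<^sup>+y. ?H (r * t) (t\<^sup>2 + (\<Sum>i<2 * p. (y i)\<^sup>2)) \<partial>(\<Pi>\<^sub>M i\<in>{..<2 * p}. lborel) \<partial>lborel)"
    unfolding M_def r_def by (rule nn_integral_PiM_ridge) measurable
  also have "\<dots> = (\<integral>\<^sup>+t. ennreal (V * ?g t) \<partial>lborel)"
  proof (rule nn_integral_cong_AE)
    \<comment> \<open>The two excluded heights, where the slice has radius 0, form a null
      set.\<close>
    have key: "(\<integral>\<^sup>+y. ?H (r * t) (t\<^sup>2 + (\<Sum>i<2 * p. (y i)\<^sup>2)) \<partial>(\<Pi>\<^sub>M i\<in>{..<2 * p}. lborel)) = ennreal (V * ?g t)"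
      if t: "t \<noteq> sqrt s" "t \<noteq> - sqrt s" for t
    proof -
      have ts: "s - t\<^sup>2 \<noteq> 0"
      proof
        assume "s - t\<^sup>2 = 0"
        then have "sqrt s = \<bar>t\<bar>" by simp
        with t show False by (auto simp: abs_if split: if_splits)
      qed
      have "(\<integral>\<^sup>+y. ?H (r * t) (t\<^sup>2 + (\<Sum>i<2 * p. (y i)\<^sup>2)) \<partial>(\<Pi>\<^sub>M i\<in>{..<2 * p}. lborel))
         = (\<integral>\<^sup>+y. ennreal (max 0 (r * t + b)) * indicator {y \<in> space (\<Pi>\<^sub>M i\<in>{..<2 * p}. lborel). (\<Sum>i<2 * p. (y i)\<^sup>2) \<le> s - t\<^sup>2} y
             \<partial>(\<Pi>\<^sub>M i\<in>{..<2 * p}. lborel))"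
        by (intro nn_integral_cong) (auto simp: indicator_def)
      also have "\<dots> = ennreal (max 0 (r * t + b)) * ennreal (V * max 0 (s - t\<^sup>2) ^ p)"
        unfolding V_def emeasure_PiM_ball[OF assms(1) ts, symmetric]
        by (rule nn_integral_cmult_indicator) measurable
      also have "\<dots> = ennreal (V * ?g t)"
      proof (cases "t \<in> {-1..1}")
        case True
        then show ?thesis using V by (simp add: ennreal_mult[symmetric] mult_ac)
      next
        \<comment> \<open>Here \<open>s \<le> 1 < t\<^sup>2\<close>, so the slice is empty and the
          cut to \<open>{-1..1}\<close> loses nothing.\<close>
        case False
        then have "1 < t\<^sup>2" using abs_le_square_iff[of t 1] by auto
        then show ?thesis using False assms(1,2) by (simp add: zero_power)
      qed
      finally show ?thesis .
    qed
    have ae: "AE t in lborel. t \<noteq> sqrt s \<and> t \<noteq> - sqrt s"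
      by (intro AE_conjI AE_lborel_singleton)
    show "AE t in lborel. (\<integral>\<^sup>+y. ?H (r * t) (t\<^sup>2 + (\<Sum>i<2 * p. (y i)\<^sup>2)) \<partial>(\<Pi>\<^sub>M i\<in>{..<2 * p}. lborel)) = ennreal (V * ?g t)"
      by (rule eventually_mono[OF ae], rule key) auto
  qed
  also have "\<dots> = ennreal (LINT t|lborel. V * ?g t)"
    using V by (intro nn_integral_eq_integral integrable_mult_right integrable_ridge_ball) auto
  also have "(LINT t|lborel. V * ?g t) = V * ridge_ball p r b s"
    unfolding ridge_ball_def by simp
  finally show "(\<integral>\<^sup>+x. ennreal (indicator {x. (\<Sum>i<Suc (2 * p). (x i)\<^sup>2) \<le> s} x * max 0 ((\<Sum>i<Suc (2 * p). w i * x i) + b)) \<partial>M)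
      = ennreal (unit_ball_vol (real (2 * p)) * ridge_ball p (sqrt (\<Sum>i<Suc (2 * p). (w i)\<^sup>2)) b s)"
    unfolding V_def r_def .
qed

text \<open>\<open>s\<close> enters the integrand only through the truncated power, so the
  difference passes under the integral and meets the pointwise bound. The factor 2 is the length of
  \<open>{-1..1}\<close>.\<close>

lemma fin_diff_ridge_ball_le:
  assumes "p > 0" "h \<ge> 0"
  shows "\<bar>fin_diff p h (ridge_ball p r b) x\<bar> \<le> 2 * (\<bar>r\<bar> + \<bar>b\<bar>) * (fact p * h ^ p)"
proof -
  let ?C = "(\<bar>r\<bar> + \<bar>b\<bar>) * (fact p * h ^ p)"
  let ?f = "\<lambda>t. indicator {-1..1} t * (max 0 (r * t + b) * fin_diff p h (\<lambda>y. max 0 y ^ p) (x - t\<^sup>2))"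
  let ?g = "\<lambda>i t. (-1) ^ i * real (p choose i) * (indicator {-1..1} t * (max 0 (r * t + b) * max 0 (x + real i * h - t\<^sup>2) ^ p))"
  have arg: "x - t\<^sup>2 + real i * h = x + real i * h - t\<^sup>2" for t :: real and i
    by simp
  have f: "?f = (\<lambda>t. \<Sum>i\<le>p. ?g i t)"
    unfolding fin_diff_def arg by (simp only: sum_distrib_left mult_ac)
  have int: "integrable lborel (?g i)" for i
    by (intro integrable_mult_right integrable_ridge_ball)
  have "fin_diff p h (ridge_ball p r b) x = (\<Sum>i\<le>p. LINT t|lborel. ?g i t)"
    unfolding fin_diff_def ridge_ball_def by simp
  also have "\<dots> = (LINT t|lborel. ?f t)"
    unfolding f using int by (intro Bochner_Integration.integral_sum[symmetric])
  finally have eq: "fin_diff p h (ridge_ball p r b) x = (LINT t|lborel. ?f t)" .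
  have pw: "\<bar>?f t\<bar> \<le> indicator {-1..1} t * ?C" for t :: real
  proof (cases "t \<in> {-1..1}")
    case True
    have "\<bar>r * t\<bar> \<le> \<bar>r\<bar> * 1" unfolding abs_mult using True by (intro mult_left_mono) auto
    then have "\<bar>max 0 (r * t + b)\<bar> \<le> \<bar>r\<bar> + \<bar>b\<bar>" by auto
    moreover have "\<bar>fin_diff p h (\<lambda>y. max 0 y ^ p) (x - t\<^sup>2)\<bar> \<le> fact p * h ^ p"
      using fin_diff_truncated_power_le[of h "p - 1" "x - t\<^sup>2"] assms by simp
    ultimately have "\<bar>max 0 (r * t + b)\<bar> * \<bar>fin_diff p h (\<lambda>y. max 0 y ^ p) (x - t\<^sup>2)\<bar> \<le> ?C"
      by (intro mult_mono) auto
    then show ?thesis using True by (simp add: abs_mult)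
  qed simp
  have "\<bar>LINT t|lborel. ?f t\<bar> \<le> (LINT t|lborel. indicator {-1..1::real} t * ?C)"
  proof (rule integral_abs_bound_integral)
    show "integrable lborel ?f" unfolding f using int by (intro Bochner_Integration.integrable_sum)
  qed (use pw in auto)
  also have "\<dots> = 2 * ?C" by simp
  finally show ?thesis unfolding eq mult.assoc .
qed

text \<open>With \<open>r = 0\<close> and \<open>b = 1\<close> the neuron is constantly 1, so these
  differences are shell volumes up to the factor \<open>unit_ball_vol (2 * p)\<close>. For the lower
  bound only \<open>t\<close> in \<open>{-1/2..1/2}\<close> is kept, where
  \<open>l - t\<^sup>2\<close> is at least 1/2.\<close>

lemma ridge_ball_shell:
  assumes "p > 0" "l \<le> u"
  shows ridge_ball_shell_nonneg: "ridge_ball p 0 1 l \<le> ridge_ball p 0 1 u"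
    and ridge_ball_shell_ge: "3/4 \<le> l \<Longrightarrow> (u - l) / 2 ^ p \<le> ridge_ball p 0 1 u - ridge_ball p 0 1 l"
proof -
  let ?f = "\<lambda>s t. indicator {-1..1} t * (max 0 (0 * t + 1) * max 0 (s - t\<^sup>2) ^ p) :: real"
  show "ridge_ball p 0 1 l \<le> ridge_ball p 0 1 u"
    unfolding ridge_ball_def
    by (intro integral_mono integrable_ridge_ball mult_left_mono power_mono) (use assms in auto)
  assume l: "3/4 \<le> l"
  have "(u - l) / 2 ^ p = (LINT t|lborel. indicator {-1/2..1/2::real} t * ((u - l) / 2 ^ p))"
    by simp
  also have "\<dots> \<le> (LINT t|lborel. ?f u t - ?f l t)"
  proof (rule integral_mono)
    show "integrable lborel (\<lambda>t. ?f u t - ?f l t)"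
      by (intro Bochner_Integration.integrable_diff integrable_ridge_ball)
    fix t :: real
    show "indicator {-1/2..1/2} t * ((u - l) / 2 ^ p) \<le> ?f u t - ?f l t"
    proof (cases "t \<in> {-1/2..1/2}")
      case False
      have "max 0 (l - t\<^sup>2) ^ p \<le> max 0 (u - t\<^sup>2) ^ p" using assms by (intro power_mono) auto
      with False show ?thesis by (auto simp: indicator_def)
    next
      case True
      then have "\<bar>t\<bar> \<le> \<bar>1/2\<bar>" by auto
      then have "t\<^sup>2 \<le> (1/2)\<^sup>2" using abs_le_square_iff by blast
      then have "t\<^sup>2 \<le> 1/4" by (simp add: power2_eq_square)
      then have a: "1/2 \<le> l - t\<^sup>2" using l by simp
      define a b where "a = l - t\<^sup>2" and "b = u - t\<^sup>2"
      have ab: "1/2 \<le> a" "a \<le> b" using a assms by (auto simp: a_def b_def)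
      obtain q where q: "p = Suc q" using assms(1) gr0_conv_Suc by auto
      \<comment> \<open>The aim is \<open>b ^ p - a ^ p \<ge> (b - a) * a ^ (p - 1)\<close>; one
        factor 1/2 is given away for a neater exponent.\<close>
      have "(b - a) * (1/2) ^ p \<le> (b - a) * a ^ q"
      proof (rule mult_left_mono)
        have "(1/2::real) ^ p \<le> (1/2) ^ q" using q by simp
        also have "\<dots> \<le> a ^ q" using ab by (intro power_mono) auto
        finally show "(1/2) ^ p \<le> a ^ q" .
      qed (use ab in auto)
      also have "\<dots> \<le> b * b ^ q - a * a ^ q"
        using mult_left_mono[OF power_mono[of a b q], of b] ab by (simp add: algebra_simps)
      finally have "(u - l) / 2 ^ p \<le> b ^ p - a ^ p"
        by (simp add: q a_def b_def power_divide)
      moreover have "max 0 (u - t\<^sup>2) = b" "max 0 (l - t\<^sup>2) = a" using ab by (auto simp: a_def b_def)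
      ultimately show ?thesis using True by simp
    qed
  qed simp
  also have "\<dots> = ridge_ball p 0 1 u - ridge_ball p 0 1 l"
    unfolding ridge_ball_def by (intro Bochner_Integration.integral_diff integrable_ridge_ball)
  finally show "(u - l) / 2 ^ p \<le> ridge_ball p 0 1 u - ridge_ball p 0 1 l" .
qed

subsection \<open>Networks correlating with the target\<close>

text \<open>The centre \<open>(2 * j + 1) / (4 * D)\<close> is an extremum with value
  \<open>(-1) ^ j\<close>. The tolerance \<open>1 / (6 * D)\<close> is a phase of
  \<open>pi / 3\<close>, whose cosine is 1/2.\<close>

lemma sin_shell_ge:
  fixes D q :: real and j :: nat
  assumes "D > 0" and q: "\<bar>q - (2 * real j + 1) / (4 * D)\<bar> \<le> 1 / (6 * D)"
  shows "1/2 \<le> (-1) ^ j * sin (2 * pi * D * q)"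
proof -
  define \<theta> where "\<theta> = 2 * pi * D * (q - (2 * real j + 1) / (4 * D))"
  have "\<bar>\<theta>\<bar> = 2 * pi * D * \<bar>q - (2 * real j + 1) / (4 * D)\<bar>"
    using assms(1) by (simp add: \<theta>_def abs_mult)
  also have "\<dots> \<le> 2 * pi * D * (1 / (6 * D))"
    using assms by (intro mult_left_mono) auto
  also have "\<dots> = pi / 3" using assms(1) by simp
  finally have \<theta>: "\<bar>\<theta>\<bar> \<le> pi / 3" .
  have "2 * pi * D * q = real j * pi + (\<theta> + pi / 2)"
    using assms(1) by (simp add: \<theta>_def field_simps)
  then have "sin (2 * pi * D * q) = (-1) ^ j * cos \<theta>"
    by (simp only: sin_add[of "real j * pi"]) (simp add: sin_add)
  then have "(-1) ^ j * sin (2 * pi * D * q) = cos \<theta>"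
    by (simp flip: power_mult_distrib)
  also have "cos \<theta> = cos \<bar>\<theta>\<bar>" by simp
  also have "cos \<bar>\<theta>\<bar> \<ge> cos (pi / 3)"
    using \<theta> by (intro cos_monotone_0_pi_le) auto
  finally show ?thesis by (simp add: cos_60)
qed

lemma sum_extend_zero:
  fixes F :: "nat \<Rightarrow> real \<Rightarrow> real"
  assumes "n \<le> d" "\<And>i. F i 0 = 0"
  shows "(\<Sum>i<d. F i (if i < n then x i else 0)) = (\<Sum>i<n. F i (x i))"
  by (rule sum.mono_neutral_cong_right) (use assms in auto)

text \<open>The pointwise bound is integrated over the shell inside the coordinate subspace of
  dimension \<open>2 * p + 1\<close>, padded with zeros to reach \<open>unit_ball d\<close>. Up to
  the common factor \<open>V\<close>, \<open>G s\<close> is the integral of the network over the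
  ball of squared radius \<open>s\<close>.\<close>

lemma shell_correlation:
  fixes p d k :: nat
  assumes p: "p > 0" and n: "Suc (2 * p) \<le> d" and lu: "0 \<le> l" "l \<le> u" "u \<le> 1"
    and big: "\<And>x. x \<in> unit_ball d \<Longrightarrow> l < (eucl_norm d x)\<^sup>2 \<Longrightarrow> (eucl_norm d x)\<^sup>2 \<le> u \<Longrightarrow> c \<le> \<sigma> * relu_net2 d k v W b b0 x"
  defines "G \<equiv> \<lambda>s. (\<Sum>j<k. v j * ridge_ball p (sqrt (\<Sum>i<Suc (2 * p). (W j i)\<^sup>2)) (b j) s) + b0 * ridge_ball p 0 1 s"
  shows "c * (ridge_ball p 0 1 u - ridge_ball p 0 1 l) \<le> \<sigma> * (G u - G l)"
proof -
  define M where "M = (\<Pi>\<^sub>M i\<in>{..<Suc (2 * p)}. (lborel :: real measure))"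
  define V where "V = unit_ball_vol (real (2 * p))"
  define Q where "Q x = (\<Sum>i<Suc (2 * p). (x i)\<^sup>2)" for x :: "nat \<Rightarrow> real"
  define e where "e x = (\<lambda>i. if i < Suc (2 * p) then x i else 0)" for x :: "nat \<Rightarrow> real"
  define N where "N x = relu_net2 d k v W b b0 (e x)" for x
  have V: "V > 0" by (simp add: V_def)
  have Q0: "Q x \<ge> 0" for x unfolding Q_def by (rule sum_nonneg) simp
  have norm: "(eucl_norm d (e x))\<^sup>2 = Q x" for x
    using sum_extend_zero[of "Suc (2 * p)" d "\<lambda>_ y. y\<^sup>2" x] n Q0[of x]
    by (simp add: eucl_norm_def e_def Q_def)
  have lin: "(\<Sum>i<d. g i * e x i) = (\<Sum>i<Suc (2 * p). g i * x i)" for g x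
    using sum_extend_zero[of "Suc (2 * p)" d "\<lambda>i y. g i * y" x] n by (simp add: e_def)
  \<comment> \<open>The constant 1 is the neuron with zero weights and bias 1; it also represents
    the output bias.\<close>
  have one: "has_bochner_integral M (\<lambda>x. indicator {x. Q x \<le> s} x) (V * ridge_ball p 0 1 s)" if "s \<le> 1" for s
    using has_bochner_integral_ridge_ball[OF p that, of "\<lambda>_. 0" 1] by (simp add: M_def Q_def V_def)
  have ind: "has_bochner_integral M (\<lambda>x. indicator {x. Q x \<le> s} x * N x) (V * G s)" if "s \<le> 1" for s
  proof -
    let ?r = "\<lambda>j. sqrt (\<Sum>i<Suc (2 * p). (W j i)\<^sup>2)"
    have "has_bochner_integral M
        (\<lambda>x. (\<Sum>j<k. v j * (indicator {x. Q x \<le> s} x * max 0 ((\<Sum>i<Suc (2 * p). W j i * x i) + b j)))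
             + b0 * indicator {x. Q x \<le> s} x)
        ((\<Sum>j<k. v j * (V * ridge_ball p (?r j) (b j) s)) + b0 * (V * ridge_ball p 0 1 s))"
      using has_bochner_integral_ridge_ball[OF p that, of "W j" "b j" for j] one[OF that]
      unfolding M_def Q_def V_def
      by (intro has_bochner_integral_add has_bochner_integral_sum has_bochner_integral_mult_right) auto
    moreover have "(\<Sum>j<k. v j * (V * ridge_ball p (?r j) (b j) s)) + b0 * (V * ridge_ball p 0 1 s) = V * G s"
      by (simp only: G_def distrib_left sum_distrib_left mult_ac)
    moreover have "(\<lambda>x. (\<Sum>j<k. v j * (indicator {x. Q x \<le> s} x * max 0 ((\<Sum>i<Suc (2 * p). W j i * x i) + b j)))
             + b0 * indicator {x. Q x \<le> s} x) = (\<lambda>x. indicator {x. Q x \<le> s} x * N x)"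
      by (simp only: N_def relu_net2_def lin distrib_left sum_distrib_left mult_ac)
    ultimately show ?thesis by simp
  qed
  have l1: "l \<le> 1" using lu by simp
  have "has_bochner_integral M (\<lambda>x. c * (indicator {x. Q x \<le> u} x - indicator {x. Q x \<le> l} x))
      (c * (V * ridge_ball p 0 1 u - V * ridge_ball p 0 1 l))"
    by (intro has_bochner_integral_mult_right has_bochner_integral_diff one lu l1)
  moreover have "has_bochner_integral M (\<lambda>x. \<sigma> * (indicator {x. Q x \<le> u} x * N x - indicator {x. Q x \<le> l} x * N x))
      (\<sigma> * (V * G u - V * G l))"
    by (intro has_bochner_integral_mult_right has_bochner_integral_diff ind lu l1)
  moreover have "c * (indicator {x. Q x \<le> u} x - indicator {x. Q x \<le> l} x)
      \<le> \<sigma> * (indicator {x. Q x \<le> u} x * N x - indicator {x. Q x \<le> l} x * N x)" for x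
  proof (cases "l < Q x \<and> Q x \<le> u")
    case True
    have "(eucl_norm d (e x))\<^sup>2 \<le> 1" using norm[of x] True lu by simp
    then have "eucl_norm d (e x) \<le> 1" by (simp add: abs_square_le_1 abs_le_iff)
    then have "e x \<in> unit_ball d" using n by (simp add: unit_ball_def e_def)
    then have "c \<le> \<sigma> * N x" using big[of "e x"] True by (simp add: norm N_def)
    then show ?thesis using True by simp
  next
    \<comment> \<open>Off the shell the two indicators agree and both sides are 0.\<close>
    case False
    then show ?thesis using lu by (auto simp: indicator_def)
  qed
  ultimately have "c * (V * ridge_ball p 0 1 u - V * ridge_ball p 0 1 l) \<le> \<sigma> * (V * G u - V * G l)"
    by (metis (no_types, lifting) has_bochner_integral_iff integral_mono)
  then have "V * (c * (ridge_ball p 0 1 u - ridge_ball p 0 1 l)) \<le> V * (\<sigma> * (G u - G l))"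
    by (simp add: algebra_simps)
  then show ?thesis using V by simp
qed

text \<open>By linearity each neuron contributes separately; its weight norm is at most the sum of
  absolute values, hence at most \<open>d * B\<close>.\<close>

lemma fin_diff_network_le:
  assumes "p > 0" "h \<ge> 0" "Suc (2 * p) \<le> d" and wb: "weights_bounded d k B v W b b0"
  shows "\<bar>fin_diff p h (\<lambda>s. (\<Sum>j<k. v j * ridge_ball p (sqrt (\<Sum>i<Suc (2 * p). (W j i)\<^sup>2)) (b j) s) + b0 * ridge_ball p 0 1 s) x\<bar>
     \<le> 2 * (fact p * h ^ p) * (real k * (B * (real d * B + B)) + B)"
proof -
  let ?r = "\<lambda>j. sqrt (\<Sum>i<Suc (2 * p). (W j i)\<^sup>2)"
  let ?C = "fact p * h ^ p"
  have C: "?C \<ge> 0" using assms by simp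
  have B: "B \<ge> 0" using wb by (auto simp: weights_bounded_def)
  have eq: "fin_diff p h (\<lambda>s. (\<Sum>j<k. v j * ridge_ball p (?r j) (b j) s) + b0 * ridge_ball p 0 1 s) x
     = (\<Sum>j<k. v j * fin_diff p h (ridge_ball p (?r j) (b j)) x) + b0 * fin_diff p h (ridge_ball p 0 1) x"
    unfolding fin_diff_def distrib_left sum.distrib sum_distrib_left
    by (subst sum.swap) (simp add: mult_ac)
  have "\<bar>fin_diff p h (\<lambda>s. (\<Sum>j<k. v j * ridge_ball p (?r j) (b j) s) + b0 * ridge_ball p 0 1 s) x\<bar>
     \<le> (\<Sum>j<k. \<bar>v j * fin_diff p h (ridge_ball p (?r j) (b j)) x\<bar>) + \<bar>b0 * fin_diff p h (ridge_ball p 0 1) x\<bar>"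
    unfolding eq by (rule order_trans[OF abs_triangle_ineq]) (intro add_right_mono sum_abs)
  also have "\<dots> \<le> (\<Sum>j<k. B * (2 * (real d * B + B) * ?C)) + B * (2 * 1 * ?C)"
  proof (intro add_mono sum_mono)
    fix j assume "j \<in> {..<k}"
    then have j: "\<bar>v j\<bar> \<le> B" "\<bar>b j\<bar> \<le> B" "\<And>i. i < d \<Longrightarrow> \<bar>W j i\<bar> \<le> B"
      using wb by (auto simp: weights_bounded_def)
    have "?r j \<le> (\<Sum>i<Suc (2 * p). \<bar>W j i\<bar>)"
      using L2_set_le_sum_abs[of "W j" "{..<Suc (2 * p)}"] by (simp only: L2_set_def)
    also have "\<dots> \<le> (\<Sum>i<Suc (2 * p). B)"
      using j(3) assms(3) by (intro sum_mono) auto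
    also have "\<dots> \<le> real d * B"
      using assms(3) B by (simp only: sum_constant card_lessThan) (intro mult_right_mono, auto)
    finally have r: "?r j \<le> real d * B" .
    have r0: "?r j \<ge> 0" by (intro real_sqrt_ge_zero sum_nonneg) auto
    have "\<bar>fin_diff p h (ridge_ball p (?r j) (b j)) x\<bar> \<le> 2 * (\<bar>?r j\<bar> + \<bar>b j\<bar>) * ?C"
      by (rule fin_diff_ridge_ball_le) (use assms in auto)
    also have "\<dots> \<le> 2 * (real d * B + B) * ?C"
      using r r0 j(2) C by (intro mult_right_mono mult_left_mono add_mono) auto
    finally show "\<bar>v j * fin_diff p h (ridge_ball p (?r j) (b j)) x\<bar> \<le> B * (2 * (real d * B + B) * ?C)"
      unfolding abs_mult using j(1) B by (intro mult_mono) auto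
  next
    show "\<bar>b0 * fin_diff p h (ridge_ball p 0 1) x\<bar> \<le> B * (2 * 1 * ?C)"
      unfolding abs_mult using fin_diff_ridge_ball_le[OF assms(1,2), of 0 1 x] wb B
      by (intro mult_mono) (auto simp: weights_bounded_def)
  qed
  also have "\<dots> = 2 * ?C * (real k * (B * (real d * B + B)) + B)"
    by (simp add: algebra_simps)
  finally show ?thesis .
qed

text \<open>The shells have squared radii within \<open>1/(6 d\<^sup>3)\<close> of \<open>(2 (J + i) + 1) / (4 d\<^sup>3)\<close> for \<open>i \<le> p\<close>, the
  outermost extrema of the target, where it has absolute value at least half of its amplitude.\<close>
lemma relu_net2_width_bound:
  fixes p d k :: nat
  assumes p: "p > 0" and n: "Suc (2 * p) \<le> d" and wb: "weights_bounded d k B v W b b0"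
    and approx: "\<And>x. x \<in> unit_ball d \<Longrightarrow> \<bar>relu_net2 d k v W b b0 x - f_target d x\<bar> \<le> \<epsilon>"
    and eps: "\<epsilon> \<le> 1 / (8 * pi * real d ^ 3)"
  shows "1 / (8 * pi * real d ^ 3) * (1 / (3 * real d ^ 3) / 2 ^ p)
     \<le> 4 * (fact p * (1 / (2 * real d ^ 3)) ^ p) * (real k * (B * (real d * B + B)) + B)"
proof -
  define D where "D = real d ^ 3"
  \<comment> \<open>In the squared radius the target has period \<open>1 / D\<close>, so
    \<open>h\<close> is half a period. \<open>J\<close> is chosen so that the last centre, with
    index \<open>J + p\<close>, is \<open>1 - 1 / (4 * D)\<close>, the outermost extremum in the
    ball. The constant \<open>c\<close> is a quarter of the amplitude: the target reaches
    \<open>2 * c\<close> on the shells, and an error of at most \<open>c\<close> leaves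
    \<open>c\<close>.\<close>
  define h where "h = 1 / (2 * D)"
  define J where "J = 2 * d ^ 3 - 1 - p"
  define c where "c = 1 / (8 * pi * D)"
  define u where "u = (2 * real J + 1) / (4 * D) + 1 / (6 * D)"
  define l where "l = (2 * real J + 1) / (4 * D) - 1 / (6 * D)"
  define G where "G s = (\<Sum>j<k. v j * ridge_ball p (sqrt (\<Sum>i<Suc (2 * p). (W j i)\<^sup>2)) (b j) s) + b0 * ridge_ball p 0 1 s" for s
  define K where "K = ridge_ball p 0 1"
  have d3: "d \<ge> 3" using p n by simp
  have "d ^ 3 \<ge> d ^ 1" using d3 by (intro power_increasing) auto
  then have "J = 2 * d ^ 3 - (1 + p)" "1 + p \<le> 2 * d ^ 3" using n by (auto simp: J_def)
  then have J: "real J = 2 * D - 1 - real p" by (simp add: of_nat_diff D_def)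
  have "d * 3 ^ 2 \<le> d * d ^ 2" using d3 by (intro mult_left_mono power_mono) auto
  then have "9 * d \<le> d ^ 3" by (simp add: power2_eq_square power3_eq_cube)
  then have "real (9 * d) \<le> real (d ^ 3)" by (simp only: of_nat_le_iff)
  then have "9 * real d \<le> D" by (simp add: D_def)
  moreover have "real (Suc (2 * p)) \<le> real d" using n by (simp only: of_nat_le_iff)
  then have "18 * real p + 9 \<le> 9 * real d" by simp
  ultimately have D: "18 * real p + 9 \<le> D" by (rule order_trans[rotated])
  have D0: "D > 0" using d3 by (simp add: D_def)
  have ul: "l \<le> u" using D0 by (simp add: u_def l_def)
  have lu: "u - l = 1 / (3 * D)" by (simp add: u_def l_def field_simps)
  have "(6 * real p + 5) / (12 * D) \<le> 1/4" using D D0 by (simp add: pos_divide_le_eq)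
  moreover have "l = 1 - (6 * real p + 5) / (12 * D)" using D0 by (simp add: l_def J field_simps)
  ultimately have l: "3/4 \<le> l" by simp
  \<comment> \<open>The outermost shell, \<open>i = p\<close>, ends at
    \<open>1 - 1 / (12 * D)\<close>.\<close>
  have up: "u + real i * h \<le> 1" if "i \<le> p" for i
  proof -
    have "u + real i * h = 1 - (6 * (real p - real i) + 1) / (12 * D)"
      using D0 by (simp add: u_def h_def J field_simps)
    then show ?thesis using that D0 by simp
  qed
  have step: "c * (K (u + real i * h) - K (l + real i * h)) \<le> (-1) ^ (J + i) * (G (u + real i * h) - G (l + real i * h))"
    if i: "i \<le> p" for i
    unfolding K_def G_def
  proof (rule shell_correlation[OF p n])
    show "0 \<le> l + real i * h" using l D0 by (simp add: h_def)
    show "l + real i * h \<le> u + real i * h" using ul by simp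
    show "u + real i * h \<le> 1" by (rule up[OF i])
    fix x assume x: "x \<in> unit_ball d" and q: "l + real i * h < (eucl_norm d x)\<^sup>2" "(eucl_norm d x)\<^sup>2 \<le> u + real i * h"
    have ctr: "(2 * real (J + i) + 1) / (4 * D) = (2 * real J + 1) / (4 * D) + real i * h"
      using D0 by (simp add: h_def field_simps)
    have "1/2 \<le> (-1) ^ (J + i) * sin (2 * pi * D * (eucl_norm d x)\<^sup>2)"
      by (rule sin_shell_ge[OF D0], unfold ctr) (use q in \<open>simp add: u_def l_def abs_le_iff\<close>)
    then have "1/2 / (2 * pi * D) \<le> (-1) ^ (J + i) * sin (2 * pi * D * (eucl_norm d x)\<^sup>2) / (2 * pi * D)"
      using D0 by (intro divide_right_mono) auto
    then have f: "2 * c \<le> (-1) ^ (J + i) * f_target d x"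
      by (simp add: f_target_def c_def mult.commute[of D pi] flip: D_def)
    have "\<bar>(-1) ^ (J + i) * (relu_net2 d k v W b b0 x - f_target d x)\<bar> \<le> c"
      using approx[OF x] eps by (simp add: abs_mult power_abs c_def D_def)
    then show "c \<le> (-1) ^ (J + i) * relu_net2 d k v W b b0 x"
      using f by (simp add: right_diff_distrib abs_le_iff)
  qed
  have Kmono: "0 \<le> K (u + real i * h) - K (l + real i * h)" for i
    using ridge_ball_shell_nonneg[OF p, of "l + real i * h" "u + real i * h"] ul by (simp add: K_def)
  have c0: "c > 0" using D0 by (simp add: c_def)
  \<comment> \<open>All shells contribute with the same sign, so the innermost one alone bounds the
    whole sum from below.\<close>
  have "c * ((u - l) / 2 ^ p) \<le> c * (K (u + real 0 * h) - K (l + real 0 * h))"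
    using ridge_ball_shell_ge[OF p ul l] c0 by (intro mult_left_mono) (auto simp: K_def)
  also have "\<dots> = real (p choose 0) * (c * (K (u + real 0 * h) - K (l + real 0 * h)))" by simp
  also have "\<dots> \<le> (\<Sum>i\<le>p. real (p choose i) * (c * (K (u + real i * h) - K (l + real i * h))))"
    by (rule member_le_sum) (use Kmono c0 in auto)
  also have "\<dots> \<le> (\<Sum>i\<le>p. real (p choose i) * ((-1) ^ (J + i) * (G (u + real i * h) - G (l + real i * h))))"
    by (intro sum_mono mult_left_mono step) auto
  \<comment> \<open>The signs of the target, weighted by binomial coefficients, assemble into finite
    differences at the two ends of the shell.\<close>
  also have "\<dots> = (-1) ^ J * (fin_diff p h G u - fin_diff p h G l)"
    unfolding fin_diff_def sum_subtractf[symmetric] sum_distrib_left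
    by (intro sum.cong) (simp_all add: power_add algebra_simps)
  also have "\<dots> \<le> \<bar>fin_diff p h G u\<bar> + \<bar>fin_diff p h G l\<bar>"
    by (rule order_trans[OF abs_ge_self]) (simp add: abs_mult power_abs abs_triangle_ineq4)
  also have "\<dots> \<le> 2 * (fact p * h ^ p) * (real k * (B * (real d * B + B)) + B)
      + 2 * (fact p * h ^ p) * (real k * (B * (real d * B + B)) + B)"
    unfolding G_def using D0 by (intro add_mono fin_diff_network_le p n wb) (auto simp: h_def)
  also have "\<dots> = 4 * (fact p * h ^ p) * (real k * (B * (real d * B + B)) + B)"
    by simp
  finally show ?thesis by (simp only: lu c_def h_def D_def)
qed

subsection \<open>The width bound\<close>

text \<open>The exponent on the left is \<open>(ln 2 / 2) * x * ln x\<close> up to a linear term, on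
  the right \<open>x * ln x\<close> up to a logarithmic one.\<close>

lemma eventually_width_growth:
  "eventually (\<lambda>x::real. 400 * x ^ 6 * (x + 1) * 4 powr x * (2 powr (1/2 * x * ln x) + 1) \<le> x powr (x - 2)) at_top"
  by real_asymp

lemma relu_net2_width_ge:
  fixes d k :: nat
  assumes d: "d \<ge> 3" and wb: "weights_bounded d k (2 ^ (d+1) / (2 * pi * real d ^ 3)) v W b b0"
    and approx: "\<And>x. x \<in> unit_ball d \<Longrightarrow> \<bar>relu_net2 d k v W b b0 x - f_target d x\<bar> \<le> \<epsilon>"
    and eps: "\<epsilon> \<le> 1 / (8 * pi * real d ^ 3)"
  shows "real d powr (real d - 2) \<le> 400 * real d ^ 6 * (real d + 1) * 4 powr real d * (real k + 1)"
proof -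
  \<comment> \<open>The largest \<open>p\<close> with \<open>2 * p + 1 \<le> d\<close>; hence
    \<open>2 * p \<ge> d - 2\<close>.\<close>
  define p where "p = (d - 1) div 2"
  have p: "p > 0" "Suc (2 * p) \<le> d" "d \<le> 2 * p + 2" "2 * p \<le> d" using d by (auto simp: p_def)
  define D where "D = real d ^ 3"
  define B where "B = 2 ^ (d+1) / (2 * pi * D)"
  define X where "X = real k * (B * (real d * B + B)) + B"
  have d0: "real d > 0" using d by simp
  have D1: "D \<ge> 1" unfolding D_def using d by (intro one_le_power) simp
  have "B = 2 ^ d / (pi * D)" by (simp add: B_def)
  also have "\<dots> \<le> 2 ^ d / 1"
    using D1 pi_gt3 mult_mono[of 1 pi 1 D] by (intro divide_left_mono) auto
  finally have B: "B \<le> 2 ^ d" by simp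
  have B0: "B \<ge> 0" using D1 by (simp add: B_def)
  have X0: "X \<ge> 0" using B0 by (simp add: X_def)
  have "1 / (8 * pi * D) * (1 / (3 * D) / 2 ^ p) \<le> 4 * (fact p * (1 / (2 * D)) ^ p) * X"
    using relu_net2_width_bound[OF p(1,2) wb approx eps] by (simp only: D_def B_def X_def)
  also have "\<dots> \<le> 4 * (1 / (4 * (real d)\<^sup>2)) ^ p * X"
  proof (intro mult_right_mono mult_left_mono X0)
    have "fact p * (1 / (2 * D)) ^ p \<le> real p ^ p * (1 / (2 * D)) ^ p"
      using fact_le_power[of p, where 'a=real] D1 by (intro mult_right_mono) auto
    also have "\<dots> = (real p / (2 * D)) ^ p" by (simp add: power_divide)
    also have "\<dots> \<le> (1 / (4 * (real d)\<^sup>2)) ^ p"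
    proof (rule power_mono)
      have "real p / (2 * D) \<le> (real d / 2) / (2 * D)"
        using p(4) D1 by (intro divide_right_mono) auto
      also have "\<dots> = 1 / (4 * (real d)\<^sup>2)"
        using d0 by (simp add: D_def power2_eq_square power3_eq_cube)
      finally show "real p / (2 * D) \<le> 1 / (4 * (real d)\<^sup>2)" .
    qed (use D1 in auto)
    finally show "fact p * (1 / (2 * D)) ^ p \<le> (1 / (4 * (real d)\<^sup>2)) ^ p" .
  qed simp
  finally have main: "1 / (8 * pi * D) * (1 / (3 * D) / 2 ^ p) \<le> 4 * (1 / (4 * (real d)\<^sup>2)) ^ p * X" .
  have "(4 * (real d)\<^sup>2) ^ p = (2 * (2 * (real d)\<^sup>2)) ^ p" by simp
  also have "\<dots> = 2 ^ p * (2 * (real d)\<^sup>2) ^ p" by (rule power_mult_distrib)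
  finally have four: "(4 * (real d)\<^sup>2) ^ p = 2 ^ p * (2 * (real d)\<^sup>2) ^ p" .
  \<comment> \<open>The multiplier clears the denominators of \<open>main\<close>, and the
    \<open>2 ^ p\<close> lost in the shell volume is absorbed by
    \<open>(4 * d\<^sup>2) ^ p\<close>.\<close>
  have "y = 1 / (8 * pi * D) * (1 / (3 * D) / z) * (24 * pi * D\<^sup>2 * (z * y))" if "z > 0" for y z
    using D1 that by (simp add: power2_eq_square)
  from this[of "2 ^ p" "(2 * (real d)\<^sup>2) ^ p"]
  have "(2 * (real d)\<^sup>2) ^ p = 1 / (8 * pi * D) * (1 / (3 * D) / 2 ^ p) * (24 * pi * D\<^sup>2 * (4 * (real d)\<^sup>2) ^ p)"
    unfolding four by simp
  also have "\<dots> \<le> 4 * (1 / (4 * (real d)\<^sup>2)) ^ p * X * (24 * pi * D\<^sup>2 * (4 * (real d)\<^sup>2) ^ p)"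
    by (rule mult_right_mono[OF main]) simp
  also have "\<dots> = 96 * pi * D\<^sup>2 * X"
    using d0 by (simp add: power_divide)
  \<comment> \<open>Since \<open>pi < 4\<close>, \<open>96 * pi\<close> is below 384.\<close>
  also have "\<dots> \<le> 400 * D\<^sup>2 * X"
    using pi_less_4 X0 by (intro mult_right_mono) auto
  finally have up: "(2 * (real d)\<^sup>2) ^ p \<le> 400 * D\<^sup>2 * X" .
  have "real d powr (real d - 2) \<le> real d powr real (2 * p)"
    using p(3) d by (intro powr_mono) auto
  also have "\<dots> = ((real d)\<^sup>2) ^ p" using d0 by (simp add: powr_realpow power_mult del: of_nat_mult)
  also have "\<dots> \<le> (2 * (real d)\<^sup>2) ^ p" by (intro power_mono) auto
  also note up
  also have "400 * D\<^sup>2 * X \<le> 400 * D\<^sup>2 * (4 ^ d * ((real d + 1) * (real k + 1)))"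
  proof (rule mult_left_mono)
    have sq: "B * B \<le> 4 ^ d"
      using mult_mono[OF B B] B0 by (simp flip: power_mult_distrib)
    have "B \<le> 4 ^ d" by (rule order_trans[OF B]) (simp add: power_mono)
    also have "\<dots> \<le> 4 ^ d * (real d + 1)" by simp
    finally have "X \<le> real k * (4 ^ d * (real d + 1)) + 4 ^ d * (real d + 1)"
      using mult_left_mono[OF mult_right_mono[OF sq, of "real d + 1"], of "real k"]
      by (simp add: X_def algebra_simps)
    then show "X \<le> 4 ^ d * ((real d + 1) * (real k + 1))" by (simp add: algebra_simps)
  qed simp
  also have "\<dots> = 400 * real d ^ 6 * (real d + 1) * 4 powr real d * (real k + 1)"
    by (simp add: D_def powr_realpow flip: power_mult)
  finally show ?thesis .
qed

theorem theorem4: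
  "\<exists>c1 c2 :: real. c1 > 0 \<and> c2 > 0 \<and>
    (\<forall>w :: nat \<Rightarrow> real \<Rightarrow> nat.
      (\<forall>d::nat. d \<ge> 2 \<longrightarrow> (\<forall>\<epsilon>::real. \<epsilon> > 0 \<longrightarrow>
         (\<exists>v W b b0. weights_bounded d (w d (1/\<epsilon>)) (2 ^ (d+1) / (2 * pi * real d ^ 3)) v W b b0 \<and>
            (\<forall>x\<in>unit_ball d. \<bar>relu_net2 d (w d (1/\<epsilon>)) v W b b0 x - f_target d x\<bar> \<le> \<epsilon>))))
      \<longrightarrow> (\<forall>d::nat. real d > c1 \<longrightarrow>
             real (w d (101 * exp 2 * pi ^ 3 * real d ^ 3)) \<ge> 2 powr (c2 * real d * ln (real d))))"
proof -
  obtain x0 :: real where x0: "\<And>x. x \<ge> x0 \<Longrightarrow>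
      400 * x ^ 6 * (x + 1) * 4 powr x * (2 powr (1/2 * x * ln x) + 1) \<le> x powr (x - 2)"
    using eventually_width_growth by (auto simp: eventually_at_top_linorder)
  \<comment> \<open>The bound \<open>d > 3\<close> makes \<open>p\<close> positive, and 1/2 is the
    exponent in the growth estimate.\<close>
  show ?thesis
  proof (rule exI[of _ "max x0 3"], rule exI[of _ "1/2"], intro conjI allI impI)
    fix w :: "nat \<Rightarrow> real \<Rightarrow> nat" and d :: nat
    assume w: "\<forall>d::nat. d \<ge> 2 \<longrightarrow> (\<forall>\<epsilon>::real. \<epsilon> > 0 \<longrightarrow>
         (\<exists>v W b b0. weights_bounded d (w d (1/\<epsilon>)) (2 ^ (d+1) / (2 * pi * real d ^ 3)) v W b b0 \<and>
            (\<forall>x\<in>unit_ball d. \<bar>relu_net2 d (w d (1/\<epsilon>)) v W b b0 x - f_target d x\<bar> \<le> \<epsilon>)))"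
      and "real d > max x0 3"
    then have d: "d \<ge> 3" "real d \<ge> x0" by auto
    define T where "T = 101 * exp 2 * pi ^ 3 * real d ^ 3"
    define k where "k = w d T"
    \<comment> \<open>An accuracy of a quarter of the amplitude suffices for the width bound, and
      \<open>1 / T\<close> is finer.\<close>
    have T: "8 * pi * real d ^ 3 \<le> T"
    proof -
      have "8 * (1 * pi) \<le> 101 * exp 2 * (pi ^ 2 * pi)"
        by (intro mult_mono) (use pi_gt3 one_le_exp_iff[of "2::real"] one_le_power[of pi 2] in \<open>auto intro: order_trans[of _ "101 * 1"]\<close>)
      then show ?thesis unfolding T_def
        by (intro mult_right_mono) (auto simp: power2_eq_square power3_eq_cube mult.assoc)
    qed
    have T0: "T > 0" and T8: "8 * pi * real d ^ 3 > 0" using d by (auto simp: T_def)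
    obtain v W b b0 where net: "weights_bounded d k (2 ^ (d+1) / (2 * pi * real d ^ 3)) v W b b0"
      "\<And>x. x \<in> unit_ball d \<Longrightarrow> \<bar>relu_net2 d k v W b b0 x - f_target d x\<bar> \<le> 1 / T"
      using w[rule_format, of d "1 / T"] d T0 by (auto simp: k_def)
    have "1 / T \<le> 1 / (8 * pi * real d ^ 3)" by (rule divide_left_mono[OF T _ mult_pos_pos[OF T0 T8]]) simp
    from relu_net2_width_ge[OF d(1) net this]
    have "400 * real d ^ 6 * (real d + 1) * 4 powr real d * (2 powr (1/2 * real d * ln (real d)) + 1)
        \<le> 400 * real d ^ 6 * (real d + 1) * 4 powr real d * (real k + 1)"
      using x0[OF d(2)] by linarith
    moreover have "400 * real d ^ 6 * (real d + 1) * 4 powr real d > 0" using d by simp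
    ultimately have "2 powr (1/2 * real d * ln (real d)) + 1 \<le> real k + 1"
      using mult_le_cancel_left_pos by blast
    then show "2 powr (1/2 * real d * ln (real d)) \<le> real (w d (101 * exp 2 * pi ^ 3 * real d ^ 3))"
      by (simp add: k_def T_def)
  qed auto
qed

end
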